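(* Let $Q$ be a system of quads of a closed oriented surface of genus at least $2$, and let $H$ be a finite subgraph of the preimage $\widetilde Q$ of $Q$ in the universal covering. Then $|E(H)|\le\frac52|\partial H|$.
   Context: A system of quads on a closed oriented surface $S$ of genus $g$ is the quadrangulation obtained from a graph with one vertex and one face cellularly embedded in $S$ (consisting of $2g$ loops) by adding a new vertex inside the unique face, joining it by $4g$ edges to the $4g$ corners of the face, and then deleting the $2g$ original loops. $\widetilde Q=p^{-1}(Q)$ where $p:\widetilde S\to S$ is the universal covering. A face of $H$ is a face of $\widetilde Q$ whose four boundary edges all belong to $H$. Each edge has two sides; $\partial H$ is the set of sides of edges of $H$ which do not lie in a face of $H$ (boundary edge sides). *)

theory Defs
  imports Complex_Main
begin

text \<open>A combinatorial map: a finite set of darts, a rotation permutation (vertices =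
orbits of sig), a fixed-point-free involution (edges = orbits of alp); faces are the
orbits of phi = sig o alp.  Each dart is one oriented edge, equivalently one side of an
edge (the side lying in the face given by the phi-orbit of the dart).\<close>

record 'a cmap =
  darts :: "'a set"
  sig :: "'a \<Rightarrow> 'a"
  alp :: "'a \<Rightarrow> 'a"

definition phi :: "'a cmap \<Rightarrow> 'a \<Rightarrow> 'a" where
  "phi M = sig M \<circ> alp M"

definition orbit :: "('a \<Rightarrow> 'a) \<Rightarrow> 'a \<Rightarrow> 'a set" where
  "orbit f x = {(f ^^ n) x | n. True}"

definition orbits :: "('a \<Rightarrow> 'a) \<Rightarrow> 'a set \<Rightarrow> 'a set set" where
  "orbits f D = orbit f ` D"

definition is_cmap :: "'a cmap \<Rightarrow> bool" where
  "is_cmap M \<longleftrightarrow> finite (darts M) \<and> bij_betw (sig M) (darts M) (darts M) \<and>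
     (\<forall>x\<in>darts M. alp M x \<in> darts M \<and> alp M x \<noteq> x \<and> alp M (alp M x) = x)"

definition euler_char :: "'a cmap \<Rightarrow> int" where
  "euler_char M = int (card (orbits (sig M) (darts M))) - int (card (orbits (alp M) (darts M)))
                  + int (card (orbits (phi M) (darts M)))"

definition genus :: "'a cmap \<Rightarrow> int" where
  "genus M = (2 - euler_char M) div 2"

definition one_vertex_one_face :: "'a cmap \<Rightarrow> bool" where
  "one_vertex_one_face M \<longleftrightarrow> is_cmap M \<and> card (orbits (sig M) (darts M)) = 1
      \<and> card (orbits (phi M) (darts M)) = 1"

text \<open>The system of quads built from a one-vertex one-face map M0.  The dart x of M0
indexes the corner between x and sig x; the new edge e_x in that corner has dart (x,False)
at the original vertex and dart (x,True) at the new vertex inside the face.  The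
original loops are deleted.  Faces of the result are the quadrilaterals
(x,F),(sig^-1(alp x),T),(alp x,F),(sig^-1 x,T).\<close>
definition quad_system :: "'a cmap \<Rightarrow> ('a \<times> bool) cmap" where
  "quad_system M0 = \<lparr> darts = darts M0 \<times> UNIV,
      sig = (\<lambda>(x,b). if b then (inv_into (darts M0) (sig M0) (alp M0 x), True)
                      else (sig M0 x, False)),
      alp = (\<lambda>(x,b). (x, \<not> b)) \<rparr>"

definition same_vertex :: "'a cmap \<Rightarrow> 'a \<Rightarrow> 'a \<Rightarrow> bool" where
  "same_vertex M x y \<longleftrightarrow> y \<in> orbit (sig M) x"

definition valid_walk :: "'a cmap \<Rightarrow> 'a \<Rightarrow> 'a list \<Rightarrow> bool" where
  "valid_walk M b w \<longleftrightarrow> set w \<subseteq> darts M \<and> (w \<noteq> [] \<longrightarrow> same_vertex M b (hd w)) \<and>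
     (\<forall>i. Suc i < length w \<longrightarrow> same_vertex M (alp M (w ! i)) (w ! Suc i))"

definition end_dart :: "'a cmap \<Rightarrow> 'a \<Rightarrow> 'a list \<Rightarrow> 'a" where
  "end_dart M b w = (if w = [] then b else alp M (last w))"

definition face_len :: "'a cmap \<Rightarrow> 'a \<Rightarrow> nat" where
  "face_len M d = (LEAST n. n > 0 \<and> (phi M ^^ n) d = d)"

definition face_walk :: "'a cmap \<Rightarrow> 'a \<Rightarrow> 'a list" where
  "face_walk M d = map (\<lambda>i. (phi M ^^ i) d) [0..<face_len M d]"

definition hstep :: "'a cmap \<Rightarrow> 'a \<Rightarrow> 'a list \<Rightarrow> 'a list \<Rightarrow> bool" where
  "hstep M b w w' \<longleftrightarrow> valid_walk M b w \<and> valid_walk M b w' \<and>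
     (\<exists>w1 w2 d. d \<in> darts M \<and> w' = w1 @ w2 \<and>
        (w = w1 @ [d, alp M d] @ w2 \<or> w = w1 @ face_walk M d @ w2))"

definition homotopic :: "'a cmap \<Rightarrow> 'a \<Rightarrow> 'a list \<Rightarrow> 'a list \<Rightarrow> bool" where
  "homotopic M b = (\<lambda>x y. hstep M b x y \<or> hstep M b y x)\<^sup>*\<^sup>*"

definition cpre :: "'a cmap \<Rightarrow> 'a \<Rightarrow> ('a list \<times> 'a) set" where
  "cpre M b = {(w, d). valid_walk M b w \<and> d \<in> darts M \<and> same_vertex M (end_dart M b w) d}"

definition crel :: "'a cmap \<Rightarrow> 'a \<Rightarrow> (('a list \<times> 'a) \<times> ('a list \<times> 'a)) set" where
  "crel M b = {(p, q). p \<in> cpre M b \<and> q \<in> cpre M b \<and> snd p = snd q \<and>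
                       homotopic M b (fst p) (fst q)}"

definition cdarts :: "'a cmap \<Rightarrow> 'a \<Rightarrow> ('a list \<times> 'a) set set" where
  "cdarts M b = cpre M b // crel M b"

definition c_alp :: "'a cmap \<Rightarrow> 'a \<Rightarrow> ('a list \<times> 'a) set \<Rightarrow> ('a list \<times> 'a) set" where
  "c_alp M b X = crel M b `` ((\<lambda>(w, d). (w @ [d], alp M d)) ` X)"

definition c_sig :: "'a cmap \<Rightarrow> 'a \<Rightarrow> ('a list \<times> 'a) set \<Rightarrow> ('a list \<times> 'a) set" where
  "c_sig M b X = crel M b `` ((\<lambda>(w, d). (w, sig M d)) ` X)"

definition c_phi :: "'a cmap \<Rightarrow> 'a \<Rightarrow> ('a list \<times> 'a) set \<Rightarrow> ('a list \<times> 'a) set" where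
  "c_phi M b = c_sig M b \<circ> c_alp M b"

definition cedge :: "'a cmap \<Rightarrow> 'a \<Rightarrow> ('a list \<times> 'a) set \<Rightarrow> ('a list \<times> 'a) set set" where
  "cedge M b X = {X, c_alp M b X}"

definition cedges :: "'a cmap \<Rightarrow> 'a \<Rightarrow> ('a list \<times> 'a) set set set" where
  "cedges M b = cedge M b ` cdarts M b"

definition cvertex :: "'a cmap \<Rightarrow> 'a \<Rightarrow> ('a list \<times> 'a) set \<Rightarrow> 'a list set" where
  "cvertex M b X = {w'. \<exists>(w, d)\<in>X. homotopic M b w w'}"

definition cvertices :: "'a cmap \<Rightarrow> 'a \<Rightarrow> 'a list set set" where
  "cvertices M b = cvertex M b ` cdarts M b"

definition cface :: "'a cmap \<Rightarrow> 'a \<Rightarrow> ('a list \<times> 'a) set \<Rightarrow> ('a list \<times> 'a) set set" where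
  "cface M b X = orbit (c_phi M b) X"

text \<open>Boundary sides of the subgraph with edge set E: sides of edges of E whose face is
not a face of E (i.e. not all edges of that face belong to E).\<close>
definition bdry :: "'a cmap \<Rightarrow> 'a \<Rightarrow> ('a list \<times> 'a) set set set \<Rightarrow> ('a list \<times> 'a) set set" where
  "bdry M b E = {X \<in> cdarts M b. cedge M b X \<in> E \<and> \<not> (\<forall>Y\<in>cface M b X. cedge M b Y \<in> E)}"

end

(* Write 4F for the number of non-boundary sides. The inequality says that E \<ge> 5/2 F.
   In the universal cover, order the vertices by distance from the base point: each vertex has one
   or two neighbours below it, two exactly when it is the top of a (unique) square, and each square
   has one bottom and one top vertex. The two upper edges of a square determine it, which gives 2F
   edges. As degrees are at least 5, the two lower edges of a square cannot both end in vertices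
   with two parents, so one of them is no upper edge of any square; such an edge lies in at most
   two squares, which gives F/2 further edges.

   To obtain this order without planar topology, the cover is modelled explicitly. A vertex is the
   list of labels along its leftmost descending path to the base point (last label first), darts
   act on such lists by left and right shifts within the spheres, and this action is shown to kill
   backtracks and squares, so that it is well defined on homotopy classes of walks. *)

theory Submission
  imports Defs
begin

section \<open>Normal forms for vertices of the universal cover\<close>

text \<open>\<open>rho c\<close> is the rotation at vertices of colour \<open>c\<close>, acting on edge labels.\<close>

locale square_rotations =
  fixes D :: "'a set" and rho rhoi :: "bool \<Rightarrow> 'a \<Rightarrow> 'a" and base_colour :: bool
  assumes rho_in [simp]: "x \<in> D \<Longrightarrow> rho c x \<in> D"
    and rhoi_in [simp]: "x \<in> D \<Longrightarrow> rhoi c x \<in> D"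
    and rho_rhoi [simp]: "x \<in> D \<Longrightarrow> rho c (rhoi c x) = x"
    and rhoi_rho [simp]: "x \<in> D \<Longrightarrow> rhoi c (rho c x) = x"
    and square: "x \<in> D \<Longrightarrow> rho c (rho (\<not> c) (rho c x)) = rhoi (\<not> c) x"
    and rho1: "x \<in> D \<Longrightarrow> rho c x \<noteq> x"
    and rho2: "x \<in> D \<Longrightarrow> rho c (rho c x) \<noteq> x"
    and rho3: "x \<in> D \<Longrightarrow> rho c (rho c (rho c x)) \<noteq> x"
    and rho4: "x \<in> D \<Longrightarrow> rho c (rho c (rho c (rho c x))) \<noteq> x"
begin

lemma rho_eq_iff: "x \<in> D \<Longrightarrow> y \<in> D \<Longrightarrow> rho c x = y \<longleftrightarrow> x = rhoi c y"
  by auto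

lemma rhoi_eq_iff: "x \<in> D \<Longrightarrow> y \<in> D \<Longrightarrow> rhoi c x = y \<longleftrightarrow> x = rho c y"
  by auto

text \<open>Rotating by one to four places moves every label. These are the forms in which this
  arises when labels are compared with \<open>hd v\<close> and its neighbours in the
  rotation.\<close>

lemma short_cycles:
  assumes "x \<in> D"
  shows "rho c x \<noteq> x" "rho c (rho c x) \<noteq> x"  "rho c (rho c x) \<noteq> rho c x"
    "rho c (rho c x) \<noteq> rhoi c x" "rho c x \<noteq> rhoi c x"
    "rhoi c x \<noteq> x" "rhoi c x \<noteq> rho c x"
    "rhoi c (rhoi c x) \<noteq> x" "rhoi c (rhoi c x) \<noteq> rhoi c x" "rhoi c (rhoi c x) \<noteq> rho c x"
    "rhoi c (rhoi c (rhoi c x)) \<noteq> x" "rhoi c (rhoi c (rhoi c x)) \<noteq> rhoi c x"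
    "rhoi c (rhoi c (rhoi c x)) \<noteq> rho c x"
    "rhoi c (rhoi c (rhoi c x)) \<noteq> rhoi c (rhoi c x)"
    "x \<noteq> rho c x" "x \<noteq> rho c (rho c x)" "x \<noteq> rhoi c x" "x \<noteq> rhoi c (rhoi c x)"
    "rho c x \<noteq> rho c (rho c x)" "rhoi c x \<noteq> rho c (rho c x)"
    "rho c x \<noteq> rhoi c (rhoi c x)" "rhoi c x \<noteq> rhoi c (rhoi c x)"
  using assms rho1[of _ c] rho2[of _ c] rho3[of _ c] rho4[of _ c]
  by (metis rho_in rhoi_in rho_rhoi rhoi_rho)+

section \<open>Vertices as lists of labels\<close>

primrec col :: "'a list \<Rightarrow> bool" where
  "col [] = base_colour"
| "col (x # v) = (\<not> col v)"

lemma col_length: "col v = (if even (length v) then base_colour else \<not> base_colour)"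
  by (induction v) auto

text \<open>The darts at a vertex \<open>v \<noteq> []\<close>, in the order of rotation: the left parent \<open>hd v\<close>, the first
child (of which \<open>v\<close> is the right parent), the tree children ending with \<open>last_label v\<close>, and, if
\<open>two v\<close>, the right parent. \<open>left\<close> and \<open>right\<close> give the neighbours of \<open>v\<close> in its sphere.\<close>

primrec two :: "'a list \<Rightarrow> bool" where
  "two [] = False"
| "two (x # v) = (v \<noteq> [] \<and>
     x = (if two v then rhoi (col v) (rhoi (col v) (hd v)) else rhoi (col v) (hd v)))"

definition last_label :: "'a list \<Rightarrow> 'a" where
  "last_label v = (if two v then rhoi (col v) (rhoi (col v) (hd v)) else rhoi (col v) (hd v))"

text \<open>The last tree child of \<open>v\<close> is shared with \<open>right v\<close>, so it is
  the one that acquires a second parent; children of the root have only the root.\<close>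

lemma two_Cons: "two (x # v) \<longleftrightarrow> v \<noteq> [] \<and> x = last_label v"
  by (simp add: last_label_def)

text \<open>The first child is left out because it is listed under its left parent
  \<open>left v\<close>; thus every vertex gets a single list.\<close>

definition tree_child :: "'a list \<Rightarrow> 'a \<Rightarrow> bool" where
  "tree_child v x \<longleftrightarrow> x \<in> D \<and>
     (v \<noteq> [] \<longrightarrow> x \<noteq> hd v \<and> x \<noteq> rho (col v) (hd v) \<and> (two v \<longrightarrow> x \<noteq> rhoi (col v) (hd v)))"

primrec nf :: "'a list \<Rightarrow> bool" where
  "nf [] = True"
| "nf (x # v) = (nf v \<and> tree_child v x)"

primrec left :: "'a list \<Rightarrow> 'a list" where
  "left [] = []"
| "left (x # v) =
     (if v \<noteq> [] \<and> x = rho (col v) (rho (col v) (hd v)) then last_label (left v) # left v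
      else rhoi (col v) x # v)"

primrec right :: "'a list \<Rightarrow> 'a list" where
  "right [] = []"
| "right (x # v) =
     (if two (x # v) then rho (col v) (rho (col v) (hd (right v))) # right v
      else rho (col v) x # v)"

text \<open>Movement along an edge. The first child of \<open>v\<close> is the last tree child of
  \<open>left v\<close>, and the right parent of \<open>v\<close> is the right neighbour of its left
  parent \<open>tl v\<close>.\<close>

definition step :: "'a list \<Rightarrow> 'a \<Rightarrow> 'a list" where
  "step v x =
     (if v \<noteq> [] \<and> x = hd v then tl v
      else if v \<noteq> [] \<and> x = rho (col v) (hd v) then last_label (left v) # left v
      else if two v \<and> x = rhoi (col v) (hd v) then right (tl v)
      else x # v)"

section \<open>Neighbours within a sphere\<close>

lemma hd_in: "nf v \<Longrightarrow> v \<noteq> [] \<Longrightarrow> hd v \<in> D"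
  by (cases v) (auto simp: tree_child_def)

lemma length_left [simp]: "length (left v) = length v"
  by (induction v) auto

lemma length_right [simp]: "length (right v) = length v"
  by (induction v) (auto simp del: two.simps)

lemma left_Nil [simp]: "left v = [] \<longleftrightarrow> v = []"
  by (metis length_left length_0_conv)

lemma right_Nil [simp]: "right v = [] \<longleftrightarrow> v = []"
  by (metis length_right length_0_conv)

lemma col_left [simp]: "col (left v) = col v"
  by (simp add: col_length)

lemma col_right [simp]: "col (right v) = col v"
  by (simp add: col_length)

declare two.simps(2) [simp del]
declare two_Cons [simp]

lemma last_label_child:
  assumes "nf v" "v \<noteq> []"
  shows "tree_child v (last_label v)"
  using hd_in[OF assms] short_cycles[OF hd_in[OF assms], of "col v"]
  by (auto simp: tree_child_def last_label_def)

lemma second_child: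
  assumes "nf v" "v \<noteq> []"
  shows "tree_child v (rho (col v) (rho (col v) (hd v)))"
  using hd_in[OF assms] short_cycles[OF hd_in[OF assms], of "col v"]
  by (auto simp: tree_child_def)

text \<open>Right after the last tree child the rotation meets a parent, so the label preceding a
  tree child cannot be the last one.\<close>

lemma not_last_rhoi:
  assumes "tree_child v x" "nf v"
  shows "\<not> two (rhoi (col v) x # v)"
  using assms hd_in[of v] short_cycles[of x "col v"]
  by (auto simp: tree_child_def last_label_def rhoi_eq_iff split: if_splits)

lemma nf_left: "nf v \<Longrightarrow> nf (left v)"
proof (induction v)
  case (Cons x v)
  then show ?case
    using hd_in[of v] last_label_child[of "left v"]
    by (auto simp: tree_child_def rhoi_eq_iff)
qed simp

text \<open>Follow a face from \<open>tl v\<close> up to \<open>v\<close> and on to the first child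
  of \<open>v\<close>: the next dart carries the label on the right-hand side. That it is the last
  label of \<open>left v\<close> is the reason why squares close.\<close>

lemma last_label_left:
  "nf v \<Longrightarrow> v \<noteq> [] \<Longrightarrow> last_label (left v) = rho (\<not> col v) (rho (col v) (hd v))"
proof (induction v)
  case (Cons x v)
  have x: "x \<in> D" using Cons.prems by (auto simp: tree_child_def)
  have sq: "rhoi (\<not> col v) (rhoi (col v) x) = rho (col v) (rho (\<not> col v) x)"
    using square[OF x, of "\<not> col v"] x by (metis rhoi_rho rho_in)
  show ?case
  proof (cases "v \<noteq> [] \<and> x = rho (col v) (rho (col v) (hd v))")
    case True
    then have h: "hd v \<in> D" using Cons.prems hd_in by auto
    have "last_label (left v) = rho (\<not> col v) (rho (col v) (hd v))"
      using Cons True by auto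
    \<comment> \<open>\<open>left (x # v)\<close> is a last child here and so has two parents, which
      puts its last tree child two places before its own label.\<close>
    moreover have "last_label (left (x # v)) =
        rhoi (\<not> col v) (rhoi (\<not> col v) (last_label (left v)))"
      using True by (simp add: last_label_def[of "_ # _"])
    ultimately show ?thesis using True h sq by simp
  next
    case False
    then have "left (x # v) = rhoi (col v) x # v" by auto
    moreover have "\<not> two (rhoi (col v) x # v)"
      using not_last_rhoi Cons.prems by auto
    ultimately show ?thesis using sq by (simp add: last_label_def[of "_ # _"] del: two_Cons)
  qed
qed simp

text \<open>\<open>left\<close> passes to another parent exactly from the second child of a non-root
  vertex and lands on a last child; \<open>right\<close> passes over exactly from a last child.
  Otherwise both move among the children of one vertex, and \<open>not_last_rhoi\<close> keeps the
  cases apart.\<close>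

lemma right_left: "nf v \<Longrightarrow> right (left v) = v"
proof (induction v)
  case (Cons x v)
  then show ?case
    using not_last_rhoi[of v x] by (auto simp: tree_child_def simp del: two_Cons) (auto)
qed simp

lemma next_child:
  assumes "nf (x # v)" "\<not> two (x # v)"
  shows "tree_child v (rho (col v) x)"
  using assms hd_in[of v] short_cycles[of "hd v" "col v"]
  by (auto simp: tree_child_def last_label_def rho_eq_iff split: if_splits)

lemma nf_right: "nf v \<Longrightarrow> nf (right v)"
proof (induction v)
  case (Cons x v)
  then show ?case
    using next_child[of x v] second_child[of "right v"] by (cases "two (x # v)") auto
qed simp

lemma left_right: "nf v \<Longrightarrow> left (right v) = v"
proof (induction v)
  case (Cons x v)
  show ?case
  proof (cases "two (x # v)")
    case True
    then show ?thesis using Cons by auto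
  next
    case False
    \<comment> \<open>Cancelling \<open>rho\<close> would make \<open>x\<close> the label of the
      first child, which is not listed under \<open>v\<close>.\<close>
    have "rho (col v) x = rho (col v) (rho (col v) (hd v)) \<Longrightarrow> v \<noteq> [] \<Longrightarrow> False"
      using Cons.prems hd_in[of v] by (simp add: tree_child_def rho_eq_iff)
    then show ?thesis using False Cons.prems by (auto simp: tree_child_def simp del: two_Cons)
  qed
qed simp

text \<open>This is \<open>last_label_left\<close> at \<open>right v\<close>, read backwards:
  \<open>x\<close> is the last label of \<open>left (right v) = v\<close>, so the label before it
  belongs to the edge from \<open>right v\<close> to its first child.\<close>

lemma right_parent_label:
  assumes "nf (x # v)" "two (x # v)"
  shows "rhoi (\<not> col v) x = rho (col v) (hd (right v))"
proof -
  have "last_label (left (right v)) = rho (\<not> col v) (rho (col v) (hd (right v)))"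
    using last_label_left[of "right v"] nf_right assms by auto
  then show ?thesis
    using assms left_right[of v] hd_in[of "right v"] nf_right[of v] by auto
qed

section \<open>Moving along an edge\<close>

lemma step_hd: "step (x # v) x = v"
  by (simp add: step_def)

lemma step_child: "tree_child v x \<Longrightarrow> step v x = x # v"
  by (auto simp: step_def tree_child_def)

lemma step_first:
  "nf v \<Longrightarrow> v \<noteq> [] \<Longrightarrow> step v (rho (col v) (hd v)) = last_label (left v) # left v"
  using short_cycles(1)[OF hd_in] by (simp add: step_def)

lemma step_right:
  assumes "nf (x # v)" "two (x # v)"
  shows "step (x # v) (rhoi (\<not> col v) x) = right v"
  using assms short_cycles[of x "\<not> col v"] by (auto simp: step_def tree_child_def)

lemma dart_cases:
  assumes "nf v" "x \<in> D"
  obtains (child) "tree_child v x"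
  | (parent) u where "v = x # u"
  | (first) "v \<noteq> []" "x = rho (col v) (hd v)"
  | (right) y u where "v = y # u" "two v" "x = rhoi (\<not> col u) y"
  using assms by (cases v) (auto simp: tree_child_def)

lemma nf_step:
  assumes "nf v" "x \<in> D" shows "nf (step v x)"
  using assms
proof (cases rule: dart_cases)
  case child then show ?thesis using assms by (simp add: step_child)
next
  case (parent u) then show ?thesis using assms by (simp add: step_hd)
next
  case first then show ?thesis
    using assms nf_left last_label_child by (simp add: step_first)
next
  case (right y u) then show ?thesis
    using assms nf_right step_right by auto
qed

text \<open>Tree child and left parent undo each other, and so do first child and right parent,
  because \<open>left\<close> and \<open>right\<close> are inverse and the labels at both ends
  agree.\<close>

lemma step_step:
  assumes "nf v" "x \<in> D" shows "step (step v x) x = v"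
  using assms
proof (cases rule: dart_cases)
  case child then show ?thesis by (simp add: step_child step_hd)
next
  case (parent u) then show ?thesis using assms by (simp add: step_hd step_child)
next
  case first
  let ?w = "last_label (left v) # left v"
  have "rhoi (\<not> col v) (last_label (left v)) = x"
    using first assms last_label_left by (simp add: hd_in)
  moreover have "nf ?w" "two ?w"
    using assms first nf_left last_label_child by auto
  ultimately have "step ?w x = right (left v)"
    using step_right[of "last_label (left v)" "left v"] by auto
  then show ?thesis using first assms step_first right_left by auto
next
  case (right y u)
  then have nfu: "nf u" and ne: "u \<noteq> []" and y: "y = last_label u" using assms by auto
  have "x = rho (col u) (hd (local.right u))"
    using right_parent_label right assms by auto
  then have "step (local.right u) x = last_label u # u"
    using step_first[of "local.right u"] nf_right[OF nfu] ne left_right[OF nfu] by auto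
  then show ?thesis using right step_right assms y by auto
qed

lemma col_step:
  assumes "nf v" "x \<in> D" shows "col (step v x) = (\<not> col v)"
  using assms
proof (cases rule: dart_cases)
  case (right y u) then show ?thesis using assms step_right by auto
qed (use assms in \<open>auto simp: step_child step_hd step_first\<close>)

text \<open>\<open>left\<close> is designed to follow the rotation of the left parent backwards.
  Through this a square closes at its bottom vertex.\<close>

lemma step_previous:
  assumes "nf (x # v)"
  shows "step v (rhoi (col v) x) = left (x # v)"
proof (cases "v \<noteq> [] \<and> x = rho (col v) (rho (col v) (hd v))")
  case True
  then show ?thesis using assms hd_in[of v] step_first[of v] by auto
next
  case False
  then have "tree_child v (rhoi (col v) x)"
    using nf_left[OF assms] by auto
  then show ?thesis using False step_child by auto
qed

section \<open>Faces and upward edges of the model\<close>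

text \<open>A model dart \<open>(v, x)\<close> starts at \<open>v\<close> with label \<open>x\<close>; \<open>turn\<close> goes to the next dart of its face,
\<open>flip\<close> to the opposite dart. Darts in \<open>bottom\<close> start at the bottom vertex of their face.\<close>

definition turn :: "'a list \<times> 'a \<Rightarrow> 'a list \<times> 'a" where
  "turn = (\<lambda>(v, x). (step v x, rho (\<not> col v) x))"

definition flip :: "'a list \<times> 'a \<Rightarrow> 'a list \<times> 'a" where
  "flip = (\<lambda>(v, x). (step v x, x))"

definition model_darts :: "('a list \<times> 'a) set" where
  "model_darts = {(v, x). nf v \<and> x \<in> D}"

definition bottom :: "('a list \<times> 'a) set" where
  "bottom = {(v, x). nf v \<and> tree_child v x}"

text \<open>An upper edge of a square, taken upwards from the right parent of its top;
  \<open>last_up\<close> is the one from the left parent.\<close>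

definition first_up :: "('a list \<times> 'a) set" where
  "first_up = {(v, x). nf v \<and> v \<noteq> [] \<and> x = rho (col v) (hd v)}"

definition last_up :: "('a list \<times> 'a) set" where
  "last_up = {(v, x). nf v \<and> v \<noteq> [] \<and> x = last_label v}"

definition up :: "('a list \<times> 'a) set" where
  "up = first_up \<union> bottom"

lemma turn_in: "p \<in> model_darts \<Longrightarrow> turn p \<in> model_darts"
  by (auto simp: model_darts_def turn_def nf_step)

text \<open>The square with bottom \<open>v\<close> between the consecutive labels
  \<open>rhoi (col v) x\<close> and \<open>x\<close>. Its sides run through \<open>x # v\<close> and
  \<open>left (x # v)\<close>; its top is the first child of the former and the last tree child of
  the latter.\<close>

lemma turn_bottom:
  assumes "nf v" "tree_child v x"
  shows "turn (v, x) = (x # v, rho (\<not> col v) x)"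
    and "(turn ^^ 2) (v, x) = (last_label (left (x # v)) # left (x # v), last_label (left (x # v)))"
    and "flip ((turn ^^ 2) (v, x)) = (left (x # v), last_label (left (x # v)))"
    and "flip ((turn ^^ 3) (v, x)) = (v, rhoi (col v) x)"
    and "(turn ^^ 4) (v, x) = (v, x)"
proof -
  have nf: "nf (x # v)" and x: "x \<in> D" using assms by (auto simp: tree_child_def)
  show 1: "turn (v, x) = (x # v, rho (\<not> col v) x)"
    using assms by (simp add: turn_def step_child)
  have ll: "last_label (left (x # v)) = rho (col v) (rho (\<not> col v) x)"
    using last_label_left[OF nf] by simp
  show 2: "(turn ^^ 2) (v, x) = (last_label (left (x # v)) # left (x # v), last_label (left (x # v)))"
    using step_first[OF nf] ll assms(1)
    by (simp add: numeral_2_eq_2 1 del: left.simps) (simp add: turn_def del: left.simps)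
  show "flip ((turn ^^ 2) (v, x)) = (left (x # v), last_label (left (x # v)))"
    unfolding 2 by (simp add: flip_def step_hd)
  have "rho (\<not> col v) (last_label (left (x # v))) = rhoi (col v) x"
    using square[OF x, of "\<not> col v"] ll by simp
  moreover have "(turn ^^ 3) (v, x) = turn ((turn ^^ 2) (v, x))" by (simp add: numeral_3_eq_3 numeral_2_eq_2)
  ultimately have 3: "(turn ^^ 3) (v, x) = (left (x # v), rhoi (col v) x)"
    unfolding 2 by (simp add: turn_def step_hd del: left.simps)
  have closed: "step (left (x # v)) (rhoi (col v) x) = v"
    using step_step[of v "rhoi (col v) x"] step_previous[OF nf] assms(1) x by simp
  then show "flip ((turn ^^ 3) (v, x)) = (v, rhoi (col v) x)"
    unfolding 3 by (simp add: flip_def)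
  have "(turn ^^ 4) (v, x) = turn ((turn ^^ 3) (v, x))" by (simp add: eval_nat_numeral)
  then show "(turn ^^ 4) (v, x) = (v, x)"
    unfolding 3 using closed x by (simp add: turn_def del: left.simps)
qed

text \<open>A tree child is already there; a right parent or a sole parent is one turn away, the
  left one of two parents two turns, and a first child three.\<close>

lemma reaches_bottom:
  assumes "p \<in> model_darts"
  shows "\<exists>j<4. (turn ^^ j) p \<in> bottom"
proof -
  obtain v x where p: "p = (v, x)" and v: "nf v" and x: "x \<in> D"
    using assms by (auto simp: model_darts_def)
  have rightmost: "turn (y # u, rhoi (\<not> col u) y) \<in> bottom" if "nf (y # u)" "two (y # u)" for y u
  proof -
    have "turn (y # u, rhoi (\<not> col u) y) = (right u, rho (col u) (rho (col u) (hd (right u))))"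
      using step_right[OF that] right_parent_label[OF that] by (simp add: turn_def)
    then show ?thesis
      using second_child[of "right u"] that nf_right[of u] by (auto simp: bottom_def)
  qed
  have parent1: "turn (y # u, y) \<in> bottom" if "nf (y # u)" "\<not> two (y # u)" for y u
    using next_child[OF that] that by (simp add: turn_def bottom_def step_hd)
  have parent2: "turn (turn (y # u, y)) \<in> bottom" if n: "nf (y # u)" and t: "two (y # u)" for y u
  proof -
    have t1: "turn (y # u, y) = (u, rho (col u) y)" by (simp add: turn_def step_hd)
    obtain z w where u: "u = z # w" using t by (cases u) auto
    have z: "z \<in> D" using n u by (simp add: tree_child_def)
    show ?thesis
    \<comment> \<open>\<open>y\<close> is the last tree child of \<open>u\<close>, so the next dart
      at \<open>u\<close> leads to the right parent if there is one, and else to the only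
      parent.\<close>
    proof (cases "two u")
      case True
      then have "rho (col u) y = rhoi (\<not> col w) z"
        using t u z by (simp add: last_label_def[of "_ # _"] del: two_Cons) (simp add: last_label_def[of "_ # _"])
      then show ?thesis using rightmost[of z w] True n u t1 by auto
    next
      case False
      then have "rho (col u) y = z"
        using t u z by (auto simp: last_label_def[of "_ # _"] simp del: two_Cons) (auto simp: last_label_def[of "_ # _"])
      then show ?thesis using parent1[of z w] False n u t1 by auto
    qed
  qed
  show ?thesis
    using v x
  proof (cases rule: dart_cases)
    case child
    then show ?thesis using v p by (intro exI[of _ 0]) (simp add: bottom_def)
  next
    case (parent u)
    show ?thesis
    proof (cases "two v")
      case True
      then show ?thesis using parent2[of x u] parent v p
        by (intro exI[of _ 2]) (simp add: numeral_2_eq_2)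
    next
      case False
      then show ?thesis using parent1[of x u] parent v p
        by (intro exI[of _ 1]) simp
    qed
  next
    case first
    let ?y = "last_label (left v)"
    have "turn p = (?y # left v, ?y)"
      using first p step_first[OF v] last_label_left[OF v] by (simp add: turn_def)
    moreover have "nf (?y # left v)" using first v nf_left last_label_child by auto
    ultimately show ?thesis using parent2[of ?y "left v"] first
      by (intro exI[of _ 3]) (simp add: numeral_3_eq_3)
  next
    case (right y u)
    then show ?thesis using rightmost[of y u] v p
      by (intro exI[of _ 1]) simp
  qed
qed

lemma funpow_turn_in: "p \<in> model_darts \<Longrightarrow> (turn ^^ j) p \<in> model_darts"
  by (induction j) (simp_all add: turn_in)

lemma inj_on_turn: "inj_on turn model_darts"
proof (rule inj_onI)
  fix p q assume *: "p \<in> model_darts" "q \<in> model_darts" "turn p = turn q"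
  obtain v x w y where pq: "p = (v, x)" "q = (w, y)" by force
  have D: "nf v" "x \<in> D" "nf w" "y \<in> D" using * pq by (auto simp: model_darts_def)
  have e: "step v x = step w y" "rho (\<not> col v) x = rho (\<not> col w) y"
    using * pq by (auto simp: turn_def)
  then have "col v = col w"
    using col_step[OF D(1,2)] col_step[OF D(3,4)] by simp
  then have "x = y"
    using arg_cong[OF e(2), of "rhoi (\<not> col v)"] D by simp
  moreover have "v = w"
    using arg_cong[OF e(1), of "\<lambda>u. step u x"] step_step[OF D(1,2)] step_step[OF D(3,4)] \<open>x = y\<close>
    by metis
  ultimately show "p = q" using pq by simp
qed

text \<open>Faces started at the bottom are known to close up; the turns leading there are cancelled
  by injectivity.\<close>

lemma turn_4:
  assumes "p \<in> model_darts" shows "(turn ^^ 4) p = p"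
proof -
  obtain j where "(turn ^^ j) p \<in> bottom" using reaches_bottom[OF assms] by auto
  then have "(turn ^^ 4) ((turn ^^ j) p) = (turn ^^ j) p"
    using turn_bottom(5) by (auto simp: bottom_def)
  then have *: "(turn ^^ j) ((turn ^^ 4) p) = (turn ^^ j) p"
    using fun_cong[OF funpow_add[of 4 j turn]] fun_cong[OF funpow_add[of j 4 turn]]
    by (simp only: comp_apply add.commute[of 4])
  have "inj_on (turn ^^ j) model_darts"
  proof (induction j)
    case (Suc j)
    have "(turn ^^ j) ` model_darts \<subseteq> model_darts"
      using funpow_turn_in by blast
    then show ?case
      using comp_inj_on[OF Suc inj_on_subset[OF inj_on_turn]] by (simp add: o_def)
  qed simp
  then show ?thesis
    by (rule inj_onD[OF _ * funpow_turn_in[OF assms] assms])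
qed

text \<open>An edge joins a vertex either to its left parent, and then its upward dart is in
  \<open>bottom\<close>, or to its right parent, and then it is in \<open>first_up\<close>.\<close>

lemma up_flip:
  assumes "p \<in> model_darts" shows "flip p \<in> up \<longleftrightarrow> p \<notin> up"
proof -
  obtain v x where p: "p = (v, x)" and v: "nf v" and x: "x \<in> D"
    using assms by (auto simp: model_darts_def)
  have child: "flip (v, x) \<notin> up" if "tree_child v x" for v x
    using that short_cycles(1)[of x "\<not> col v"]
    by (auto simp: up_def first_up_def bottom_def flip_def step_child tree_child_def)
  have first: "flip (v, rho (col v) (hd v)) \<notin> up" if v: "nf v" "v \<noteq> []" for v
  proof -
    let ?y = "last_label (left v)"
    \<comment> \<open>The flipped dart is the right-parent dart of a last child, which belongs to
      neither set.\<close>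
    have "rho (col v) (hd v) = rhoi (\<not> col v) ?y" "?y \<in> D"
      using last_label_left[OF v] hd_in[OF v] by auto
    then show ?thesis
      using step_first[OF v] that short_cycles[of ?y "\<not> col v"]
      by (auto simp: up_def first_up_def bottom_def flip_def tree_child_def)
  qed
  have "p \<in> up \<or> flip p \<in> up"
    using v x
  proof (cases rule: dart_cases)
    case (right y u)
    have "step v x = local.right u" "x = rho (col u) (hd (local.right u))" "nf (local.right u)" "u \<noteq> []"
      using right v step_right right_parent_label nf_right by auto
    then show ?thesis using p by (simp add: up_def first_up_def flip_def)
  qed (use v p in \<open>auto simp: up_def bottom_def first_up_def flip_def step_hd\<close>)
  moreover have "flip p \<notin> up" if "p \<in> up"
  proof -
    have "tree_child v x \<or> v \<noteq> [] \<and> x = rho (col v) (hd v)"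
      using that p by (auto simp: up_def bottom_def first_up_def)
    then show ?thesis using child[of v x] first[of v] v p by auto
  qed
  ultimately show ?thesis by blast
qed

lemma turn_bottom_first: "p \<in> bottom \<Longrightarrow> turn p \<in> first_up"
  by (auto simp: bottom_def turn_bottom first_up_def)

lemma turn_bottom_last: "p \<in> bottom \<Longrightarrow> flip ((turn ^^ 2) p) \<in> last_up"
  using turn_bottom(3) nf_left by (auto simp: bottom_def last_up_def simp del: left.simps)

lemma last_up_subset_bottom: "last_up \<subseteq> bottom"
  using last_label_child by (auto simp: last_up_def bottom_def)

lemma first_up_bottom_disjoint: "first_up \<inter> bottom = {}"
  by (auto simp: first_up_def bottom_def tree_child_def)

text \<open>The other lower edge of the square. At a vertex with two parents, the left parent, the
  first child, this edge, the last tree child and the right parent must be five different darts,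
  which needs period four excluded.\<close>

lemma turn_bottom_middle:
  assumes "p \<in> last_up" shows "flip ((turn ^^ 3) p) \<in> bottom - last_up"
proof -
  obtain v where p: "p = (v, last_label v)" and v: "nf v" "v \<noteq> []"
    using assms by (auto simp: last_up_def)
  have "flip ((turn ^^ 3) p) = (v, rhoi (col v) (last_label v))"
    using turn_bottom(4)[OF v(1) last_label_child[OF v]] p by simp
  moreover have "tree_child v (rhoi (col v) (last_label v))"
    "rhoi (col v) (last_label v) \<noteq> last_label v"
    using hd_in[OF v] short_cycles[OF hd_in[OF v], of "col v"]
    by (auto simp: tree_child_def last_label_def)
  ultimately show ?thesis using v by (auto simp: bottom_def last_up_def)
qed

end

section \<open>Counting sides\<close>

text \<open>\<open>BO\<close> marks the bottom sides of faces, \<open>FU\<close> and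
  \<open>LU\<close> the two kinds of upper edges. The marks are arbitrary sets so that they can be
  pulled back to the cover along \<open>model\<close>.\<close>

lemma card_boundary_sides:
  fixes C :: "'d set" and A F :: "'d \<Rightarrow> 'd" and E :: "'d set set"
  assumes A_in: "\<And>X. X \<in> C \<Longrightarrow> A X \<in> C" and AA: "\<And>X. X \<in> C \<Longrightarrow> A (A X) = X"
    and F_in: "\<And>X. X \<in> C \<Longrightarrow> F X \<in> C" and F_inj: "inj_on F C"
    and E: "E \<subseteq> (\<lambda>X. {X, A X}) ` C" and fin: "finite E"
    and up: "\<And>X. X \<in> C \<Longrightarrow> A X \<in> FU \<union> BO \<longleftrightarrow> X \<notin> FU \<union> BO"
    and disj: "FU \<inter> BO = {}" and sub: "LU \<subseteq> BO"
    and turn1: "\<And>X. X \<in> C \<Longrightarrow> X \<in> BO \<Longrightarrow> F X \<in> FU"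
    and turn2: "\<And>X. X \<in> C \<Longrightarrow> X \<in> BO \<Longrightarrow> A ((F ^^ 2) X) \<in> LU"
    and turn3: "\<And>X. X \<in> C \<Longrightarrow> X \<in> LU \<Longrightarrow> A ((F ^^ 3) X) \<in> BO - LU"
    and reach: "\<And>X. X \<in> C \<Longrightarrow> \<exists>j<4. (F ^^ j) X \<in> BO"
  shows "real (card E) \<le>
    5 / 2 * real (card {X \<in> C. {X, A X} \<in> E \<and> \<not> (\<forall>Y\<in>orbit F X. {Y, A Y} \<in> E)})"
proof -
  \<comment> \<open>\<open>I0\<close> stands for the faces of the subgraph and \<open>U\<close> for
    its edges.\<close>
  define S where "S = {X \<in> C. {X, A X} \<in> E}"
  define I where "I = {X \<in> S. \<forall>Y\<in>orbit F X. {Y, A Y} \<in> E}"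
  define I0 where "I0 = I \<inter> BO"
  define U where "U = S \<inter> (FU \<union> BO)"
  have "S \<subseteq> \<Union> E" by (auto simp: S_def)
  moreover have "finite (\<Union> E)" using fin E by auto
  ultimately have finS: "finite S" by (rule finite_subset)
  have finI: "finite I" using finS by (simp add: I_def)
  have IC: "I \<subseteq> C" and I0I: "I0 \<subseteq> I" by (auto simp: I_def I0_def S_def)
  have finI0: "finite I0" using finI by (auto simp: I0_def)
  have A_S: "A X \<in> S" if "X \<in> S" for X
    using that A_in AA by (auto simp: S_def insert_commute)
  have F_C: "(F ^^ j) X \<in> C" if "X \<in> C" for X j
    using that by (induction j) (auto simp: F_in)
  have F_inj_j: "inj_on (F ^^ j) C" for j
  proof (induction j)
    case (Suc j)
    have "(F ^^ j) ` C \<subseteq> C" using F_C by auto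
    then show ?case using comp_inj_on[OF Suc inj_on_subset[OF F_inj]] by (simp add: o_def)
  qed simp
  have F_I: "(F ^^ j) X \<in> I" if X: "X \<in> I" for X j
  proof -
    have "orbit F ((F ^^ j) X) \<subseteq> orbit F X"
    proof
      fix Y assume "Y \<in> orbit F ((F ^^ j) X)"
      then obtain n where "Y = (F ^^ n) ((F ^^ j) X)" by (auto simp: orbit_def)
      then have "Y = (F ^^ (n + j)) X" by (simp add: funpow_add)
      then show "Y \<in> orbit F X" by (auto simp: orbit_def)
    qed
    moreover have "(F ^^ j) X \<in> orbit F X" by (auto simp: orbit_def)
    ultimately show ?thesis using X F_C IC by (auto simp: I_def S_def)
  qed
  have A_inj: "inj_on A C" using AA by (metis inj_onI)

  have "bij_betw (\<lambda>X. {X, A X}) U E"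
  proof (rule bij_betw_imageI)
    show "inj_on (\<lambda>X. {X, A X}) U"
    proof (rule inj_onI)
      fix X Y assume *: "X \<in> U" "Y \<in> U" "{X, A X} = {Y, A Y}"
      then have "X = Y \<or> X = A Y" by auto
      then show "X = Y" using * up by (auto simp: U_def S_def)
    qed
    show "(\<lambda>X. {X, A X}) ` U = E"
    proof
      show "(\<lambda>X. {X, A X}) ` U \<subseteq> E" by (auto simp: U_def S_def)
      show "E \<subseteq> (\<lambda>X. {X, A X}) ` U"
      proof
        fix e assume e: "e \<in> E"
        then obtain X where X: "X \<in> C" "e = {X, A X}" using E by auto
        then have "X \<in> S" using e by (simp add: S_def)
        show "e \<in> (\<lambda>X. {X, A X}) ` U"
        proof (cases "X \<in> FU \<union> BO")
          case True
          then show ?thesis using X \<open>X \<in> S\<close> by (auto simp: U_def)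
        next
          case False
          then have "A X \<in> U" using X up A_S[OF \<open>X \<in> S\<close>] by (auto simp: U_def)
          moreover have "e = {A X, A (A X)}" using X AA by auto
          ultimately show ?thesis by blast
        qed
      qed
    qed
  qed
  then have cardE: "card E = card U" by (simp add: bij_betw_same_card)

  have "S - U = A ` U"
  proof
    show "A ` U \<subseteq> S - U" using A_S up by (auto simp: U_def S_def)
    show "S - U \<subseteq> A ` U"
    proof
      fix X assume X: "X \<in> S - U"
      then have "A X \<in> U" "X = A (A X)" using A_S up AA by (auto simp: U_def S_def)
      then show "X \<in> A ` U" by blast
    qed
  qed
  moreover have "card (A ` U) = card U"
    using A_inj by (intro card_image inj_on_subset[OF A_inj]) (auto simp: U_def S_def)
  moreover have "card S = card U + card (S - U)"
    using finS card_mono[of S U] by (subst card_Diff_subset) (auto simp: U_def intro: finite_subset)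
  ultimately have cardS: "card S = 2 * card U" by simp

  \<comment> \<open>Sort the interior sides by a number of turns leading to \<open>I0\<close>; each
    of these four iterates is injective.\<close>
  have "I \<subseteq> (\<Union>j<4::nat. {X \<in> I. (F ^^ j) X \<in> I0})"
  proof
    fix X assume X: "X \<in> I"
    then obtain j where "j < 4" "(F ^^ j) X \<in> BO" using reach IC by blast
    then show "X \<in> (\<Union>j<4::nat. {X \<in> I. (F ^^ j) X \<in> I0})"
      using X F_I by (auto simp: I0_def)
  qed
  then have "card I \<le> card (\<Union>j<4::nat. {X \<in> I. (F ^^ j) X \<in> I0})"
    using finI by (intro card_mono) auto
  also have "\<dots> \<le> (\<Sum>j<4::nat. card {X \<in> I. (F ^^ j) X \<in> I0})"
    by (rule card_UN_le) simp
  also have "\<dots> \<le> (\<Sum>j<4::nat. card I0)"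
    using IC finI0 by (intro sum_mono card_inj_on_le[OF inj_on_subset[OF F_inj_j]]) auto
  finally have cardI: "card I \<le> 4 * card I0" by simp

  have fin': "finite (S \<inter> X)" for X using finS by auto
  have IS: "I \<subseteq> S" by (auto simp: I_def)
  have inj2: "inj_on (\<lambda>X. A ((F ^^ j) X)) C" for j
    using comp_inj_on[OF F_inj_j inj_on_subset[OF A_inj], of j] F_C by (auto simp: o_def)
  \<comment> \<open>A square is determined by either of its upper edges: \<open>c1\<close> counts
    one of them and \<open>c2\<close> the other.\<close>
  have c1: "card I0 \<le> card (S \<inter> FU)"
    using F_I[of _ 1] turn1 IC I0I IS
    by (intro card_inj_on_le[OF inj_on_subset[OF F_inj]] fin') (auto simp: I0_def)
  have c2: "card I0 \<le> card (S \<inter> LU)"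
    using F_I[of _ 2] turn2 IC I0I IS
    by (intro card_inj_on_le[OF inj_on_subset[OF inj2[of 2]]] fin') (auto simp: I0_def intro!: A_S)
  \<comment> \<open>If the bottom side is in \<open>LU\<close>, the other lower edge is taken, and
    otherwise the bottom side itself. An edge is used at most once in each way, hence the factor
    2.\<close>
  have "card (I0 \<inter> LU) \<le> card (S \<inter> (BO - LU))"
    using F_I[of _ 3] turn3 IC I0I IS
    by (intro card_inj_on_le[OF inj_on_subset[OF inj2[of 3]]] fin') (auto simp: I0_def intro!: A_S)
  moreover have "card (I0 - LU) \<le> card (S \<inter> (BO - LU))"
    using IS by (intro card_mono fin') (auto simp: I0_def)
  moreover have "card I0 = card (I0 \<inter> LU) + card (I0 - LU)"
    using finI0 by (metis card_Int_Diff)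
  ultimately have c3: "card I0 \<le> 2 * card (S \<inter> (BO - LU))" by linarith

  have "U = (S \<inter> FU) \<union> ((S \<inter> LU) \<union> (S \<inter> (BO - LU)))" using sub by (auto simp: U_def)
  moreover have "card \<dots> = card (S \<inter> FU) + card ((S \<inter> LU) \<union> (S \<inter> (BO - LU)))"
    using disj sub finS by (intro card_Un_disjoint) auto
  moreover have "card ((S \<inter> LU) \<union> (S \<inter> (BO - LU))) = card (S \<inter> LU) + card (S \<inter> (BO - LU))"
    using finS by (intro card_Un_disjoint) auto
  ultimately have "card U = card (S \<inter> FU) + card (S \<inter> LU) + card (S \<inter> (BO - LU))" by simp
  then have "5 * card I0 \<le> 2 * card U" using c1 c2 c3 by linarith
  moreover have "card (S - I) = card S - card I" using IS finI by (rule card_Diff_subset[rotated])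
  \<comment> \<open>There are \<open>2 * card U - card I\<close> boundary sides, and
    \<open>card I\<close> is at most \<open>4 * card I0\<close>, hence at most 8/5 of
    \<open>card U\<close>.\<close>
  ultimately have "2 * card E \<le> 5 * card (S - I)" using cardE cardS cardI by linarith
  moreover have "S - I = {X \<in> C. {X, A X} \<in> E \<and> \<not> (\<forall>Y\<in>orbit F X. {Y, A Y} \<in> E)}"
    by (auto simp: S_def I_def)
  ultimately show ?thesis by simp
qed

section \<open>From the universal cover to the model\<close>

lemma valid_walk_Nil [simp]: "valid_walk M b []"
  by (simp add: valid_walk_def)

lemma valid_walk_Cons [simp]:
  "valid_walk M b (d # w) \<longleftrightarrow> d \<in> darts M \<and> same_vertex M b d \<and> valid_walk M (alp M d) w"
proof -
  have "(\<forall>i. Suc i < length (d # w) \<longrightarrow> same_vertex M (alp M ((d # w) ! i)) ((d # w) ! Suc i)) \<longleftrightarrow>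
    (w \<noteq> [] \<longrightarrow> same_vertex M (alp M d) (hd w)) \<and>
    (\<forall>i. Suc i < length w \<longrightarrow> same_vertex M (alp M (w ! i)) (w ! Suc i))"
    (is "(\<forall>i. ?P i) \<longleftrightarrow> _ \<and> (\<forall>i. ?Q i)")
  proof -
    have "(\<forall>i. ?P i) \<longleftrightarrow> ?P 0 \<and> (\<forall>i. ?P (Suc i))" by (metis not0_implies_Suc)
    then show ?thesis by (cases w) auto
  qed
  then show ?thesis by (auto simp: valid_walk_def)
qed

lemma end_dart_Nil [simp]: "end_dart M b [] = b"
  by (simp add: end_dart_def)

lemma end_dart_Cons [simp]: "end_dart M b (d # w) = end_dart M (alp M d) w"
  by (simp add: end_dart_def)

lemma end_dart_append [simp]:
  "end_dart M b (w1 @ w2) = end_dart M (end_dart M b w1) w2"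
  by (induction w1 arbitrary: b) auto

lemma valid_walk_append [simp]:
  "valid_walk M b (w1 @ w2) \<longleftrightarrow> valid_walk M b w1 \<and> valid_walk M (end_dart M b w1) w2"
  by (induction w1 arbitrary: b) auto

lemma hstep_valid: "hstep M b w w' \<Longrightarrow> valid_walk M b w \<and> valid_walk M b w'"
  by (simp add: hstep_def)

lemma homotopic_refl: "homotopic M b w w"
  by (simp add: homotopic_def)

lemma homotopic_sym: "homotopic M b w w' \<Longrightarrow> homotopic M b w' w"
  unfolding homotopic_def by (rule sympD[OF symp_rtranclp]) (auto intro: sympI)

lemma homotopic_trans: "homotopic M b w w' \<Longrightarrow> homotopic M b w' w'' \<Longrightarrow> homotopic M b w w''"
  unfolding homotopic_def by (rule rtranclp_trans)

lemma equiv_crel: "equiv (cpre M b) (crel M b)"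
proof (rule equivI)
  show "crel M b \<subseteq> cpre M b \<times> cpre M b" by (auto simp: crel_def)
  show "refl_on (cpre M b) (crel M b)" by (auto simp: refl_on_def crel_def homotopic_refl)
  show "sym (crel M b)" by (auto simp: sym_def crel_def homotopic_sym)
  show "trans (crel M b)" by (auto simp: trans_def crel_def intro: homotopic_trans)
qed

text \<open>\<open>c_alp\<close> and \<open>c_sig\<close> saturate the image of a whole class; for a
  map respecting the relation, one representative suffices.\<close>

lemma crel_Image_image:
  assumes "p \<in> cpre M b" and resp: "\<And>q. (p, q) \<in> crel M b \<Longrightarrow> (f p, f q) \<in> crel M b"
  shows "crel M b `` (f ` (crel M b `` {p})) = crel M b `` {f p}"
proof -
  have "(p, p) \<in> crel M b" using assms(1) equiv_crel by (meson equivE refl_onD)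
  then show ?thesis
    using resp equiv_class_eq[OF equiv_crel resp] by fastforce
qed

lemma orbits_single:
  assumes "card (orbits f D) = 1" "x \<in> D" "y \<in> D"
  shows "y \<in> orbit f x"
proof -
  obtain c where "orbits f D = {c}" using assms(1) card_1_singletonE by blast
  then have "orbit f x = c" "orbit f y = c" using assms by (auto simp: orbits_def)
  moreover have "y \<in> orbit f y" unfolding orbit_def by (auto intro: exI[of _ 0])
  ultimately show ?thesis by simp
qed

lemma orbit_card_le:
  assumes "(f ^^ j) x = x" "0 < j"
  shows "card (orbit f x) \<le> j"
proof -
  have "orbit f x \<subseteq> (\<lambda>i. (f ^^ i) x) ` {..<j}"
  proof
    fix y assume "y \<in> orbit f x"
    then obtain n where "y = (f ^^ n) x" by (auto simp: orbit_def)
    then have "y = (f ^^ (n mod j)) x" using funpow_mod_eq[OF assms(1)] by simp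
    then show "y \<in> (\<lambda>i. (f ^^ i) x) ` {..<j}" using assms(2) by auto
  qed
  then have "card (orbit f x) \<le> card ((\<lambda>i. (f ^^ i) x) ` {..<j})"
    by (intro card_mono) auto
  also have "\<dots> \<le> j"
    using card_image_le[of "{..<j}" "\<lambda>i. (f ^^ i) x"] by simp
  finally show ?thesis .
qed

section \<open>The rotations of a system of quads\<close>

locale quad_cover =
  fixes M0 :: "'a cmap" and b :: "'a \<times> bool"
  assumes unicellular: "one_vertex_one_face M0"
    and genus2: "genus M0 \<ge> 2"
    and base: "b \<in> darts (quad_system M0)"
begin

abbreviation "D \<equiv> darts M0"
abbreviation "Q \<equiv> quad_system M0"

lemma finite_D: "finite D"
  and bij_sig: "bij_betw (sig M0) D D"
  and alp_D [simp]: "x \<in> D \<Longrightarrow> alp M0 x \<in> D"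
  and alp_neq: "x \<in> D \<Longrightarrow> alp M0 x \<noteq> x"
  and alp_alp [simp]: "x \<in> D \<Longrightarrow> alp M0 (alp M0 x) = x"
  and one_vertex: "card (orbits (sig M0) D) = 1"
  and one_face: "card (orbits (phi M0) D) = 1"
  using unicellular by (auto simp: one_vertex_one_face_def is_cmap_def)

definition rho :: "bool \<Rightarrow> 'a \<Rightarrow> 'a" where
  "rho c x = (if c then inv_into D (sig M0) (alp M0 x) else sig M0 x)"

text \<open>The quadrilateral faces say that \<open>rho c \<circ> rho (\<not> c)\<close> is an involution, hence this inverse.\<close>

definition rhoi :: "bool \<Rightarrow> 'a \<Rightarrow> 'a" where
  "rhoi c x = rho (\<not> c) (rho c (rho (\<not> c) x))"

lemma sig_D [simp]: "x \<in> D \<Longrightarrow> sig M0 x \<in> D"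
  using bij_sig by (auto simp: bij_betw_def)

lemma rho_D: "x \<in> D \<Longrightarrow> rho c x \<in> D"
  using bij_sig by (auto simp: rho_def bij_betw_def intro: inv_into_into)

lemma sig_rho: "x \<in> D \<Longrightarrow> sig M0 (rho True x) = alp M0 x"
  using bij_sig by (simp add: rho_def bij_betw_def f_inv_into_f)

lemma rho_sig: "x \<in> D \<Longrightarrow> rho True (alp M0 (sig M0 x)) = x"
  using bij_sig by (simp add: rho_def bij_betw_def)

text \<open>\<open>rho False\<close> after \<open>rho True\<close> is \<open>alp M0\<close>, an
  involution.\<close>

lemma rho_square_False: "x \<in> D \<Longrightarrow> rho False (rho True (rho False (rho True x))) = x"
  by (simp add: rho_def[of False] sig_rho)

lemma rho_square_True:
  assumes "x \<in> D" shows "rho True (rho False (rho True (rho False x))) = x"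
proof -
  have "sig M0 (rho True (rho False (rho True (rho False x)))) = sig M0 x"
    using rho_square_False[of "sig M0 x"] assms by (simp add: rho_def[of False])
  then show ?thesis
    using bij_sig assms by (auto simp: bij_betw_def dest!: inj_onD intro!: rho_D)
qed

lemma rho_square: "x \<in> D \<Longrightarrow> rho c (rho (\<not> c) (rho c (rho (\<not> c) x))) = x"
  using rho_square_False rho_square_True by (cases c) auto

lemma funpow_closed: "x \<in> D \<Longrightarrow> (\<And>x. x \<in> D \<Longrightarrow> f x \<in> D) \<Longrightarrow> (f ^^ n) x \<in> D"
  by (induction n) auto

lemma orbit_rho:
  assumes "x \<in> D" shows "orbit (rho c) x = D"
proof
  show "orbit (rho c) x \<subseteq> D"
    using funpow_closed[of x "rho c"] assms rho_D by (auto simp: orbit_def)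
  show "D \<subseteq> orbit (rho c) x"
  proof
    fix y assume y: "y \<in> D"
    show "y \<in> orbit (rho c) x"
    proof (cases c)
      case False
      then have "rho c = sig M0" by (simp add: rho_def fun_eq_iff)
      then show ?thesis using orbits_single[OF one_vertex assms y] by simp
    next
      case True
      \<comment> \<open>\<open>rho True\<close> is conjugate by \<open>alp M0\<close> to the inverse
        of \<open>phi M0\<close>, so the single face makes it transitive.\<close>
      have "alp M0 x \<in> orbit (phi M0) (alp M0 y)"
        using orbits_single[OF one_face] assms y by simp
      then obtain n where n: "alp M0 x = (phi M0 ^^ n) (alp M0 y)" by (auto simp: orbit_def)
      have phi_D: "(phi M0 ^^ k) z \<in> D" if "z \<in> D" for k z
        using that by (intro funpow_closed) (auto simp: phi_def)
      have "(rho True ^^ k) (alp M0 ((phi M0 ^^ k) (alp M0 y))) = y" for k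
      proof (induction k)
        case (Suc k)
        let ?z = "(phi M0 ^^ k) (alp M0 y)"
        have z: "?z \<in> D" using phi_D y by simp
        have "(rho True ^^ Suc k) (alp M0 ((phi M0 ^^ Suc k) (alp M0 y))) =
          (rho True ^^ k) (rho True (alp M0 (phi M0 ?z)))"
          by (simp only: funpow_Suc_right[of k "rho True"] funpow.simps(2)[of k "phi M0"] o_apply)
        also have "rho True (alp M0 (phi M0 ?z)) = alp M0 ?z"
          using rho_sig[of "alp M0 ?z"] z by (simp add: phi_def)
        finally show ?case using Suc by simp
      qed (simp add: y)
      from this[of n] have "y = (rho c ^^ n) x" using n True assms by (metis alp_alp)
      then show ?thesis by (auto simp: orbit_def)
    qed
  qed
qed

text \<open>With one vertex and one face the Euler characteristic is 2 minus the number of edges, so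
  genus at least 2 gives four edges. As \<open>x\<close> and \<open>alp M0 x\<close> share an edge,
  there are more darts than edges.\<close>

lemma card_D: "card D > 4"
proof -
  obtain x where x: "x \<in> D" using base by (auto simp: quad_system_def)
  have orb: "orbit (alp M0) y = {y, alp M0 y}" if y: "y \<in> D" for y
  proof -
    have "(alp M0 ^^ n) y \<in> {y, alp M0 y}" for n using y by (induction n) auto
    moreover have "y = (alp M0 ^^ 0) y" "alp M0 y = (alp M0 ^^ 1) y" by auto
    ultimately show ?thesis unfolding orbit_def by blast
  qed
  have "orbit (alp M0) (alp M0 x) = orbit (alp M0) x" using orb[of x] orb[of "alp M0 x"] x by auto
  then have "\<not> inj_on (orbit (alp M0)) D" using x alp_neq[OF x] inj_onD alp_D by metis
  then have "card (orbits (alp M0) D) < card D"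
    unfolding orbits_def using finite_D card_image_le[of D "orbit (alp M0)"] eq_card_imp_inj_on[of D "orbit (alp M0)"]
    by linarith
  moreover have "card (orbits (alp M0) D) \<ge> 4"
    using genus2 one_vertex one_face by (simp add: genus_def euler_char_def)
  ultimately show ?thesis by simp
qed

lemma rho_aperiodic:
  assumes "x \<in> D" "0 < j" "j \<le> 4" shows "(rho c ^^ j) x \<noteq> x"
  using orbit_card_le[of j "rho c" x] orbit_rho[OF assms(1), of c] card_D assms by auto

sublocale square_rotations D rho rhoi "snd b"
proof
  fix x c assume x: "x \<in> D"
  show "rho c x \<in> D" "rhoi c x \<in> D" using x rho_D by (auto simp: rhoi_def)
  show "rho c (rhoi c x) = x" using rho_square[OF x, of c] by (simp add: rhoi_def)
  show "rhoi c (rho c x) = x" using rho_square[OF x, of "\<not> c"] by (simp add: rhoi_def)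
  show "rho c (rho (\<not> c) (rho c x)) = rhoi (\<not> c) x" by (simp add: rhoi_def)
  show "rho c x \<noteq> x" "rho c (rho c x) \<noteq> x" "rho c (rho c (rho c x)) \<noteq> x"
    "rho c (rho c (rho c (rho c x))) \<noteq> x"
    using rho_aperiodic[OF x, of 1 c] rho_aperiodic[OF x, of 2 c] rho_aperiodic[OF x, of 3 c]
      rho_aperiodic[OF x, of 4 c] by (simp_all add: eval_nat_numeral)
qed

lemma darts_Q [simp]: "d \<in> darts Q \<longleftrightarrow> fst d \<in> D"
  by (cases d) (auto simp: quad_system_def)

lemma sig_Q [simp]: "sig Q d = (rho (snd d) (fst d), snd d)"
  by (auto simp: quad_system_def rho_def split: prod.split)

lemma alp_Q [simp]: "alp Q d = (fst d, \<not> snd d)"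
  by (auto simp: quad_system_def split: prod.split)

lemma phi_Q [simp]: "phi Q d = (rho (\<not> snd d) (fst d), \<not> snd d)"
  by (simp add: phi_def)

text \<open>Each \<open>rho c\<close> is transitive on \<open>D\<close>, so there is one vertex per
  colour.\<close>

lemma same_vertex_Q:
  assumes "fst d \<in> D" "fst e \<in> D"
  shows "same_vertex Q d e \<longleftrightarrow> snd d = snd e"
proof -
  have *: "(sig Q ^^ n) d = ((rho (snd d) ^^ n) (fst d), snd d)" for n
    by (induction n) auto
  have "fst e \<in> orbit (rho (snd d)) (fst d)" using assms orbit_rho by simp
  then show ?thesis
    unfolding same_vertex_def orbit_def * by (cases e) auto
qed

section \<open>Action of walks on normal forms\<close>

definition run :: "'a list \<Rightarrow> ('a \<times> bool) list \<Rightarrow> 'a list" where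
  "run = foldl (\<lambda>v d. step v (fst d))"

lemma run_simps [simp]: "run v [] = v" "run v (d # w) = run (step v (fst d)) w"
    "run v (w @ w') = run (run v w) w'"
  by (simp_all add: run_def)

lemma run_valid:
  assumes "valid_walk Q e w" "fst e \<in> D" "nf v" "col v = snd e"
  shows "nf (run v w) \<and> col (run v w) = snd (end_dart Q e w) \<and> fst (end_dart Q e w) \<in> D"
  using assms
proof (induction w arbitrary: e v)
  case (Cons d w)
  then show ?case
    using same_vertex_Q[of e d] nf_step[of v "fst d"] col_step[of v "fst d"] by auto
qed simp

lemma face_len_Q:
  assumes "fst d \<in> D" shows "face_len Q d = 4"
  unfolding face_len_def
proof (rule Least_equality)
  obtain x c where d: "d = (x, c)" "x \<in> D" using assms by (cases d) auto
  show "0 < (4::nat) \<and> (phi Q ^^ 4) d = d"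
    using rho_square[of x c] d by (simp add: eval_nat_numeral)
  fix n :: nat assume n: "0 < n \<and> (phi Q ^^ n) d = d"
  \<comment> \<open>Length 2 would give a fixed point of \<open>alp M0\<close>; lengths 1 and 3
    change the colour.\<close>
  have "rho c (rho (\<not> c) x) \<noteq> x"
  proof (cases c)
    case False
    then show ?thesis using sig_rho[of x] alp_neq[of x] d by (simp add: rho_def[of False])
  next
    case True
    then show ?thesis using sig_rho[of "sig M0 x"] alp_neq[of "sig M0 x"] d
      by (auto simp: rho_def[of False])
  qed
  then have "n \<noteq> 1" "n \<noteq> 2" "n \<noteq> 3" using n d by (auto simp: eval_nat_numeral)
  then show "4 \<le> n" using n by linarith
qed

text \<open>Along a face walk, \<open>run\<close> performs the turns of the model, and four of them
  are the identity.\<close>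

lemma run_face_walk:
  assumes "nf v" "fst d \<in> D" "col v = snd d"
  shows "run v (face_walk Q d) = v"
proof -
  have "(turn ^^ n) (v, fst d) =
      (run v (map (\<lambda>i. (phi Q ^^ i) d) [0..<n]), fst ((phi Q ^^ n) d)) \<and>
      snd ((phi Q ^^ n) d) = col (run v (map (\<lambda>i. (phi Q ^^ i) d) [0..<n])) \<and>
      (turn ^^ n) (v, fst d) \<in> model_darts" for n
  proof (induction n)
    case (Suc n)
    then show ?case
      using col_step turn_in[of "(turn ^^ n) (v, fst d)"]
      by (auto simp: turn_def model_darts_def)
  qed (use assms in \<open>simp add: model_darts_def\<close>)
  then have "run v (face_walk Q d) = fst ((turn ^^ 4) (v, fst d))"
    using assms(2) by (simp only: face_walk_def face_len_Q fst_conv)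
  then show ?thesis
    using turn_4[of "(v, fst d)"] assms by (simp add: model_darts_def)
qed

abbreviation state :: "('a \<times> bool) list \<Rightarrow> 'a list" where
  "state \<equiv> run []"

lemma base_D: "fst b \<in> D"
  using base by simp

lemma state_valid:
  assumes "valid_walk Q b w"
  shows "nf (state w)" "col (state w) = snd (end_dart Q b w)" "fst (end_dart Q b w) \<in> D"
  using run_valid[OF assms base_D, of "[]"] by simp_all

lemma state_hstep:
  assumes "hstep Q b w w'" shows "state w = state w'"
proof -
  obtain w1 w2 d where "d \<in> darts Q" and w': "w' = w1 @ w2"
    and w: "w = w1 @ [d, alp Q d] @ w2 \<or> w = w1 @ face_walk Q d @ w2"
    and v: "valid_walk Q b w" using assms unfolding hstep_def by blast
  then have d: "fst d \<in> D" by simp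
  have v1: "valid_walk Q b w1" using v w by auto
  show ?thesis
    using w
  proof
    assume "w = w1 @ [d, alp Q d] @ w2"
    then show ?thesis using w' d step_step[OF state_valid(1)[OF v1]] by simp
  next
    assume face: "w = w1 @ face_walk Q d @ w2"
    \<comment> \<open>As the walk is valid, its first face dart \<open>d\<close> starts where
      \<open>w1\<close> ends; this gives the colour that \<open>run_face_walk\<close>
      requires.\<close>
    have "face_walk Q d = d # map (\<lambda>i. (phi Q ^^ i) d) [1..<4]"
      using d by (simp add: face_walk_def face_len_Q upt_conv_Cons)
    then have "same_vertex Q (end_dart Q b w1) d" using v face by auto
    then have "col (state w1) = snd d"
      using state_valid[OF v1] same_vertex_Q d by auto
    then show ?thesis using run_face_walk state_valid[OF v1] d w' face by simp
  qed
qed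

lemma state_homotopic: "homotopic Q b w w' \<Longrightarrow> state w = state w'"
  unfolding homotopic_def
proof (induction rule: rtranclp_induct)
  case (step y z)
  then show ?case using state_hstep[of y z] state_hstep[of z y] by metis
qed simp

lemma cpre_Q:
  "(w, d) \<in> cpre Q b \<longleftrightarrow> valid_walk Q b w \<and> fst d \<in> D \<and> col (state w) = snd d"
proof (cases "valid_walk Q b w \<and> fst d \<in> D")
  case True
  then show ?thesis
    using same_vertex_Q[of "end_dart Q b w" d] state_valid[of w] by (simp add: cpre_def)
next
  case False
  then show ?thesis by (auto simp: cpre_def)
qed

text \<open>Appending \<open>d\<close> only lengthens the common suffix \<open>w2\<close> of a
  homotopy step, and equal states keep \<open>d\<close> admissible along the way.\<close>

lemma homotopic_snoc:
  assumes "homotopic Q b w w'" "(w, d) \<in> cpre Q b"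
  shows "homotopic Q b (w @ [d]) (w' @ [d]) \<and> (w', d) \<in> cpre Q b"
  using assms(1) unfolding homotopic_def
proof (induction rule: rtranclp_induct)
  case base
  then show ?case using assms(2) by simp
next
  case (step y z)
  have st: "state y = state z" "valid_walk Q b z"
    using step(2) by (auto dest: state_hstep hstep_valid)
  then have z: "(z, d) \<in> cpre Q b" using step(3) by (simp add: cpre_Q)
  have snoc: "hstep Q b (y @ [d]) (z @ [d])"
    if h: "hstep Q b y z" and p: "(y, d) \<in> cpre Q b" "(z, d) \<in> cpre Q b" for y z
  proof -
    obtain w1 w2 e where e: "e \<in> darts Q" "z = w1 @ w2"
      "y = w1 @ [e, alp Q e] @ w2 \<or> y = w1 @ face_walk Q e @ w2"
      using h unfolding hstep_def by blast
    have "valid_walk Q b (y @ [d])" "valid_walk Q b (z @ [d])"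
      using p by (auto simp: cpre_def)
    moreover have "z @ [d] = w1 @ (w2 @ [d])"
      "y @ [d] = w1 @ [e, alp Q e] @ (w2 @ [d]) \<or> y @ [d] = w1 @ face_walk Q e @ (w2 @ [d])"
      using e(2,3) by auto
    ultimately show ?thesis
      unfolding hstep_def using e(1) by blast
  qed
  have "(\<lambda>x y. hstep Q b x y \<or> hstep Q b y x) (y @ [d]) (z @ [d])"
    using step(2,3) z snoc by auto
  then show ?case using step(3) z by (blast intro: rtranclp.rtrancl_into_rtrancl)
qed

section \<open>Darts of the universal cover\<close>

abbreviation cls :: "('a \<times> bool) list \<times> 'a \<times> bool \<Rightarrow> (('a \<times> bool) list \<times> 'a \<times> bool) set" where
  "cls p \<equiv> crel Q b `` {p}"

lemma cdarts_cls:
  assumes "X \<in> cdarts Q b"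
  obtains w d where "(w, d) \<in> cpre Q b" "X = cls (w, d)"
proof -
  obtain p where "p \<in> cpre Q b" "X = cls p"
    using assms unfolding cdarts_def by (rule quotientE)
  then show ?thesis using that by (cases p) blast
qed

lemma cls_cdarts: "p \<in> cpre Q b \<Longrightarrow> cls p \<in> cdarts Q b"
  unfolding cdarts_def by (rule quotientI)

lemma cls_eq_iff: "p \<in> cpre Q b \<Longrightarrow> q \<in> cpre Q b \<Longrightarrow> cls p = cls q \<longleftrightarrow> (p, q) \<in> crel Q b"
  by (rule eq_equiv_class_iff[OF equiv_crel])

lemma cpre_alp: "(w, d) \<in> cpre Q b \<Longrightarrow> (w @ [d], alp Q d) \<in> cpre Q b"
  by (simp add: cpre_def same_vertex_Q)

lemma cpre_sig: "(w, d) \<in> cpre Q b \<Longrightarrow> (w, sig Q d) \<in> cpre Q b"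
  by (auto simp: cpre_Q rho_D)

lemma c_alp_cls:
  assumes "(w, d) \<in> cpre Q b"
  shows "c_alp Q b (cls (w, d)) = cls (w @ [d], alp Q d)"
  unfolding c_alp_def
proof (subst crel_Image_image[OF assms])
  fix q assume "((w, d), q) \<in> crel Q b"
  then obtain w' where "q = (w', d)" "homotopic Q b w w'" "(w', d) \<in> cpre Q b"
    by (cases q) (auto simp: crel_def)
  then show "((case (w, d) of (w, d) \<Rightarrow> (w @ [d], alp Q d)),
      (case q of (w, d) \<Rightarrow> (w @ [d], alp Q d))) \<in> crel Q b"
    using cpre_alp[OF assms] cpre_alp[of w' d] homotopic_snoc[OF _ assms] by (simp add: crel_def)
qed simp

lemma c_sig_cls:
  assumes "(w, d) \<in> cpre Q b"
  shows "c_sig Q b (cls (w, d)) = cls (w, sig Q d)"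
  unfolding c_sig_def
proof (subst crel_Image_image[OF assms])
  fix q assume "((w, d), q) \<in> crel Q b"
  then obtain w' where "q = (w', d)" "homotopic Q b w w'" "(w', d) \<in> cpre Q b"
    by (cases q) (auto simp: crel_def)
  then show "((case (w, d) of (w, d) \<Rightarrow> (w, sig Q d)),
      (case q of (w, d) \<Rightarrow> (w, sig Q d))) \<in> crel Q b"
    using cpre_sig[OF assms] cpre_sig[of w' d] by (simp add: crel_def)
qed simp

lemma c_phi_cls:
  assumes "(w, d) \<in> cpre Q b"
  shows "c_phi Q b (cls (w, d)) = cls (w @ [d], phi Q d)"
  using c_alp_cls[OF assms] c_sig_cls[OF cpre_alp[OF assms]] by (simp add: c_phi_def)

lemma c_alp_in: "X \<in> cdarts Q b \<Longrightarrow> c_alp Q b X \<in> cdarts Q b"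
  by (erule cdarts_cls) (simp only: c_alp_cls cls_cdarts cpre_alp)

lemma c_sig_in: "X \<in> cdarts Q b \<Longrightarrow> c_sig Q b X \<in> cdarts Q b"
  by (erule cdarts_cls) (simp only: c_sig_cls cls_cdarts cpre_sig)

lemma c_alp_c_alp:
  assumes "X \<in> cdarts Q b" shows "c_alp Q b (c_alp Q b X) = X"
proof -
  obtain w d where p: "(w, d) \<in> cpre Q b" and X: "X = cls (w, d)"
    using assms by (rule cdarts_cls)
  let ?w = "(w @ [d]) @ [alp Q d]"
  have c: "(?w, d) \<in> cpre Q b"
    using cpre_alp[OF cpre_alp[OF p]] by simp
  \<comment> \<open>Deletion of the final backtrack, with empty suffix.\<close>
  have "hstep Q b ?w w"
    unfolding hstep_def using c p
    by (intro conjI exI[of _ w] exI[of _ "[]"] exI[of _ d]) (auto simp: cpre_def)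
  then have "homotopic Q b ?w w" by (auto simp: homotopic_def)
  then have "cls (?w, d) = cls (w, d)" using c p by (subst cls_eq_iff) (auto simp: crel_def)
  moreover have "c_alp Q b (c_alp Q b X) = cls (?w, d)"
    using c_alp_cls[OF p] c_alp_cls[OF cpre_alp[OF p]] X by simp
  ultimately show ?thesis using X by simp
qed

lemma inj_c_sig: "inj_on (c_sig Q b) (cdarts Q b)"
proof (rule inj_onI)
  fix X Y assume X: "X \<in> cdarts Q b" and Y: "Y \<in> cdarts Q b" and eq: "c_sig Q b X = c_sig Q b Y"
  obtain w d where p: "(w, d) \<in> cpre Q b" "X = cls (w, d)"
    using X by (rule cdarts_cls)
  obtain w' d' where q: "(w', d') \<in> cpre Q b" "Y = cls (w', d')"
    using Y by (rule cdarts_cls)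
  have "cls (w, sig Q d) = cls (w', sig Q d')"
    using eq unfolding p(2) q(2) c_sig_cls[OF p(1)] c_sig_cls[OF q(1)] .
  then have r: "((w, sig Q d), (w', sig Q d')) \<in> crel Q b"
    by (subst (asm) cls_eq_iff[OF cpre_sig[OF p(1)] cpre_sig[OF q(1)]])
  then have e: "rho (snd d) (fst d) = rho (snd d') (fst d')" "snd d = snd d'"
    by (auto simp: crel_def)
  have "fst d \<in> D" "fst d' \<in> D" using p q by (simp_all add: cpre_Q)
  then have "fst d = fst d'"
    using arg_cong[OF e(1), of "rhoi (snd d)"] e(2) by simp
  then have "d = d'" using e(2) by (simp add: prod_eq_iff)
  then have "((w, d), (w', d')) \<in> crel Q b" using r p q by (simp add: crel_def)
  then show "X = Y" unfolding p(2) q(2) cls_eq_iff[OF p(1) q(1)] .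
qed

lemma c_phi_in: "X \<in> cdarts Q b \<Longrightarrow> c_phi Q b X \<in> cdarts Q b"
  by (simp add: c_phi_def c_alp_in c_sig_in)

lemma inj_c_phi: "inj_on (c_phi Q b) (cdarts Q b)"
proof -
  have "inj_on (c_alp Q b) (cdarts Q b)" by (metis c_alp_c_alp inj_onI)
  then show ?thesis
    unfolding c_phi_def
    by (rule comp_inj_on) (rule inj_on_subset[OF inj_c_sig], auto simp: c_alp_in)
qed

section \<open>From darts of the cover to darts of the model\<close>

definition model :: "(('a \<times> bool) list \<times> 'a \<times> bool) set \<Rightarrow> 'a list \<times> 'a" where
  "model X = (let p = (SOME p. p \<in> X) in (state (fst p), fst (snd p)))"

text \<open>The choice of representative is harmless: members of a class share the dart, and their
  homotopic walks share the state.\<close>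

lemma model_cls:
  assumes "(w, d) \<in> cpre Q b" shows "model (cls (w, d)) = (state w, fst d)"
proof -
  have "(w, d) \<in> cls (w, d)" using assms by (simp add: crel_def homotopic_refl)
  then have "(SOME p. p \<in> cls (w, d)) \<in> cls (w, d)" by (rule someI)
  then show ?thesis
    unfolding model_def Let_def by (auto simp: crel_def dest: state_homotopic)
qed

lemma model_in:
  assumes "X \<in> cdarts Q b" shows "model X \<in> model_darts"
  using assms by (elim cdarts_cls) (auto simp: model_cls cpre_Q model_darts_def state_valid)

lemma model_c_alp:
  assumes "X \<in> cdarts Q b" shows "model (c_alp Q b X) = flip (model X)"
proof -
  obtain w d where p: "(w, d) \<in> cpre Q b" and X: "X = cls (w, d)"
    using assms by (rule cdarts_cls)
  have "model (c_alp Q b X) = (state (w @ [d]), fst (alp Q d))"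
    unfolding X c_alp_cls[OF p] by (rule model_cls[OF cpre_alp[OF p]])
  then show ?thesis using X model_cls[OF p] by (simp add: flip_def)
qed

lemma model_c_phi:
  assumes "X \<in> cdarts Q b" shows "model (c_phi Q b X) = turn (model X)"
proof -
  obtain w d where p: "(w, d) \<in> cpre Q b" and X: "X = cls (w, d)"
    using assms by (rule cdarts_cls)
  have "(w @ [d], phi Q d) \<in> cpre Q b"
    using cpre_sig[OF cpre_alp[OF p]] by simp
  then have "model (c_phi Q b X) = (state (w @ [d]), fst (phi Q d))"
    unfolding X c_phi_cls[OF p] by (rule model_cls)
  then show ?thesis using X model_cls[OF p] p by (simp add: turn_def cpre_Q)
qed

lemma model_funpow:
  assumes "X \<in> cdarts Q b"
  shows "(c_phi Q b ^^ n) X \<in> cdarts Q b \<and> model ((c_phi Q b ^^ n) X) = (turn ^^ n) (model X)"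
  using assms by (induction n) (auto simp: c_phi_in model_c_phi)

text \<open>\<open>model\<close> carries \<open>c_alp\<close> to \<open>flip\<close> and
  \<open>c_phi\<close> to \<open>turn\<close>, so the preimages of \<open>first_up\<close>,
  \<open>bottom\<close> and \<open>last_up\<close> inherit what the counting lemma asks of its
  marks.\<close>

theorem card_edges_le_boundary:
  assumes "E \<subseteq> cedges Q b" "finite E"
  shows "real (card E) \<le> 5 / 2 * real (card (bdry Q b E))"
  unfolding bdry_def cface_def cedge_def
proof (rule card_boundary_sides)
  show "inj_on (c_phi Q b) (cdarts Q b)" by (rule inj_c_phi)
  show "E \<subseteq> (\<lambda>X. {X, c_alp Q b X}) ` cdarts Q b"
    using assms(1) by (auto simp: cedges_def cedge_def)
  show "finite E" by fact
  show "(model -` first_up) \<inter> (model -` bottom) = {}" using first_up_bottom_disjoint by auto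
  show "model -` last_up \<subseteq> model -` bottom" using last_up_subset_bottom by auto
  fix X assume X: "X \<in> cdarts Q b"
  show "c_alp Q b X \<in> cdarts Q b" "c_alp Q b (c_alp Q b X) = X" "c_phi Q b X \<in> cdarts Q b"
    using X by (simp_all add: c_alp_in c_alp_c_alp c_phi_in)
  show "c_alp Q b X \<in> model -` first_up \<union> model -` bottom \<longleftrightarrow>
      X \<notin> model -` first_up \<union> model -` bottom"
    using up_flip[OF model_in[OF X]] model_c_alp[OF X] by (auto simp: up_def)
  show "\<exists>j<4. (c_phi Q b ^^ j) X \<in> model -` bottom"
    using reaches_bottom[OF model_in[OF X]] model_funpow[OF X] by auto
  show "X \<in> model -` bottom \<Longrightarrow> c_phi Q b X \<in> model -` first_up"
    using model_c_phi[OF X] turn_bottom_first by simp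
  show "X \<in> model -` bottom \<Longrightarrow> c_alp Q b ((c_phi Q b ^^ 2) X) \<in> model -` last_up"
    using model_funpow[OF X, of 2] model_c_alp turn_bottom_last by auto
  show "X \<in> model -` last_up \<Longrightarrow>
      c_alp Q b ((c_phi Q b ^^ 3) X) \<in> model -` bottom - model -` last_up"
    using model_funpow[OF X, of 3] model_c_alp turn_bottom_middle[of "model X"] by auto
qed

end

theorem theoremB1:
  fixes M0 :: "'a cmap" and b :: "'a \<times> bool"
    and VH :: "('a \<times> bool) list set set"
    and EH :: "(('a \<times> bool) list \<times> ('a \<times> bool)) set set set"
  assumes "one_vertex_one_face M0"
    and "genus M0 \<ge> 2"
    and "b \<in> darts (quad_system M0)"
    and "VH \<subseteq> cvertices (quad_system M0) b"
    and "EH \<subseteq> cedges (quad_system M0) b"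
    and "finite VH" and "finite EH"
    and "\<forall>e\<in>EH. \<forall>X\<in>e. cvertex (quad_system M0) b X \<in> VH"
  shows "real (card EH) \<le> 5 / 2 * real (card (bdry (quad_system M0) b EH))"
proof -
  interpret quad_cover M0 b
    using assms(1-3) by unfold_locales
  show ?thesis using assms(5,7) by (rule card_edges_le_boundary)
qed

end
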